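(* For every distribution $(A,B,C,D)$ of jointly distributed random variables, each with finite range: ($\mathcal I1$) if $I(A:B|C)=I(A:B)=0$, then $\square_{AB,CD}\ge 0$; ($\mathcal I2$) if $I(A:B|C)=I(B:D|C)=0$, then $\square_{AB,CD}\ge 0$; ($\mathcal I3$) if $I(A:B|C)=H(C|A,B)=0$, then $\square_{AB,CD}\ge 0$.
   Context: $H$ denotes Shannon entropy, $H(X|Y)=H(X,Y)-H(Y)$, $I(X:Y)=H(X)+H(Y)-H(X,Y)$, $I(X:Y|Z)=H(X,Z)+H(Y,Z)-H(X,Y,Z)-H(Z)$ (where $X,Y,Z$ may be tuples of random variables), and $\square_{AB,CD}:=I(C:D|A)+I(C:D|B)+I(A:B)-I(C:D)$. *)

theory Defs
  imports "HOL-Probability.Information"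
begin

(* b is the base of the logarithm.  A random variable with finite range is a function X with
   simple_function M X; its value type is arbitrary, so tuples of random variables are
   tuple-valued functions. *)

definition shannon_entropy :: "real \<Rightarrow> 'w measure \<Rightarrow> ('w \<Rightarrow> 'x) \<Rightarrow> real" where
  "shannon_entropy b M X = prob_space.entropy M b (count_space (X ` space M)) X"

definition cond_entropy :: "real \<Rightarrow> 'w measure \<Rightarrow> ('w \<Rightarrow> 'x) \<Rightarrow> ('w \<Rightarrow> 'y) \<Rightarrow> real" where
  "cond_entropy b M X Y =
     shannon_entropy b M (\<lambda>\<omega>. (X \<omega>, Y \<omega>)) - shannon_entropy b M Y"

definition mutual_info :: "real \<Rightarrow> 'w measure \<Rightarrow> ('w \<Rightarrow> 'x) \<Rightarrow> ('w \<Rightarrow> 'y) \<Rightarrow> real" where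
  "mutual_info b M X Y =
     shannon_entropy b M X + shannon_entropy b M Y - shannon_entropy b M (\<lambda>\<omega>. (X \<omega>, Y \<omega>))"

definition cond_mutual_info ::
  "real \<Rightarrow> 'w measure \<Rightarrow> ('w \<Rightarrow> 'x) \<Rightarrow> ('w \<Rightarrow> 'y) \<Rightarrow> ('w \<Rightarrow> 'z) \<Rightarrow> real" where
  "cond_mutual_info b M X Y Z =
     shannon_entropy b M (\<lambda>\<omega>. (X \<omega>, Z \<omega>)) + shannon_entropy b M (\<lambda>\<omega>. (Y \<omega>, Z \<omega>))
     - shannon_entropy b M (\<lambda>\<omega>. (X \<omega>, Y \<omega>, Z \<omega>)) - shannon_entropy b M Z"

definition ingleton ::
  "real \<Rightarrow> 'w measure \<Rightarrow> ('w \<Rightarrow> 'a) \<Rightarrow> ('w \<Rightarrow> 'b) \<Rightarrow> ('w \<Rightarrow> 'c) \<Rightarrow> ('w \<Rightarrow> 'd) \<Rightarrow> real" where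
  "ingleton b M A B C D =
     cond_mutual_info b M C D A + cond_mutual_info b M C D B
     + mutual_info b M A B - mutual_info b M C D"

(* For random variables with finite range, the quantities above are the usual sum and the
   library's conditional entropy and (conditional) mutual information. *)

context information_space
begin

lemma shannon_entropy_eq_sum:
  assumes "simple_function M X"
  shows "shannon_entropy b M X =
    - (\<Sum>x\<in>X ` space M. prob (X -` {x} \<inter> space M) * log b (prob (X -` {x} \<inter> space M)))"
  unfolding shannon_entropy_def
  by (rule entropy_simple_distributed[OF simple_distributedI[OF assms measure_nonneg refl]])

lemma shannon_entropy_superset:
  assumes X: "simple_function M X" and S: "X ` space M \<subseteq> S" "finite S"
  shows "entropy b (count_space S) X = shannon_entropy b M X"
proof -
  note D = distributed_simple_function_superset[OF X refl S]
  have "entropy b (count_space S) X =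
    - (\<Sum>x\<in>S. (if x \<in> X ` space M then prob (X -` {x} \<inter> space M) else 0) *
        log b (if x \<in> X ` space M then prob (X -` {x} \<inter> space M) else 0))"
    by (subst entropy_distr[OF D])
       (auto simp: lebesgue_integral_count_space_finite S measure_nonneg)
  also have "\<dots> = shannon_entropy b M X"
    unfolding shannon_entropy_eq_sum[OF X]
    using S by (auto intro!: sum.mono_neutral_cong_right)
  finally show ?thesis .
qed

lemma mutual_information_superset:
  assumes X: "simple_function M X" and Y: "simple_function M Y"
    and S: "X ` space M \<subseteq> S" "finite S" and T: "Y ` space M \<subseteq> T" "finite T"
  shows "mutual_information b (count_space S) (count_space T) X Y = mutual_info b M X Y"
proof -
  have XY: "simple_function M (\<lambda>\<omega>. (X \<omega>, Y \<omega>))"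
    using X Y by (rule simple_function_Pair)
  have ST: "(\<lambda>\<omega>. (X \<omega>, Y \<omega>)) ` space M \<subseteq> S \<times> T" "finite (S \<times> T)"
    using S T by auto
  have eq: "count_space S \<Otimes>\<^sub>M count_space T = count_space (S \<times> T)"
    using S T by (simp add: pair_measure_count_space)
  note DX = distributed_simple_function_superset[OF X refl S]
  note DY = distributed_simple_function_superset[OF Y refl T]
  note DXY = distributed_simple_function_superset[OF XY refl ST, folded eq]
  have "mutual_information b (count_space S) (count_space T) X Y =
    entropy b (count_space S) X + entropy b (count_space T) Y
    - entropy b (count_space S \<Otimes>\<^sub>M count_space T) (\<lambda>\<omega>. (X \<omega>, Y \<omega>))"
    by (rule mutual_information_eq_entropy_conditional_entropy_distr
          [OF sigma_finite_measure_count_space_finite sigma_finite_measure_count_space_finite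
            DX _ DY _ DXY])
       (use S T in \<open>auto simp: eq integrable_count_space measure_nonneg\<close>)
  then show ?thesis
    unfolding mutual_info_def eq
    by (simp add: shannon_entropy_superset[OF X S] shannon_entropy_superset[OF Y T]
        shannon_entropy_superset[OF XY ST])
qed

lemma mutual_info_eq:
  assumes "simple_function M X" "simple_function M Y"
  shows "mutual_info b M X Y = \<I>(X ; Y)"
  using assms by (simp add: mutual_information_superset simple_functionD(1))

lemma cond_entropy_eq:
  assumes X: "simple_function M X" and Y: "simple_function M Y"
  shows "cond_entropy b M X Y = \<H>(X | Y)"
proof -
  have "mutual_info b M X Y = \<H>(X) - \<H>(X | Y)"
    by (simp add: mutual_info_eq mutual_information_eq_entropy_conditional_entropy X Y)
  then show ?thesis
    by (simp add: mutual_info_def cond_entropy_def shannon_entropy_def)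
qed

lemma cond_mutual_info_eq:
  assumes X: "simple_function M X" and Y: "simple_function M Y" and Z: "simple_function M Z"
  shows "cond_mutual_info b M X Y Z = \<I>(X ; Y | Z)"
proof -
  have YZ: "simple_function M (\<lambda>\<omega>. (Y \<omega>, Z \<omega>))"
    using Y Z by (rule simple_function_Pair)
  have fin: "finite (X ` space M)" "finite (Y ` space M)" "finite (Z ` space M)"
    using X Y Z by (auto dest: simple_functionD(1))
  then have eq: "count_space (Y ` space M) \<Otimes>\<^sub>M count_space (Z ` space M) =
      count_space (Y ` space M \<times> Z ` space M)"
    by (simp add: pair_measure_count_space)
  have "\<I>(X ; Y | Z) = mutual_info b M X (\<lambda>\<omega>. (Y \<omega>, Z \<omega>)) - mutual_info b M X Z"
    unfolding conditional_mutual_information_def eq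
    using fin by (subst (1 2) mutual_information_superset) (auto simp: X Z YZ)
  then show ?thesis
    by (simp add: cond_mutual_info_def mutual_info_def)
qed

end

end

theory Submission
  imports Defs
begin

text \<open>
  Let \<open>q(a,b,c,d) = p(a,c,d) p(b,c,d) / p(c,d)\<close>, the distribution with the \<open>ACD\<close> and \<open>BCD\<close>
  marginals of \<open>p\<close> that makes \<open>A\<close> and \<open>B\<close> independent given \<open>(C,D)\<close>. The Ingleton expression is the
  \<open>p\<close>-expectation of
  \<open>log (p(a,c,d) p(b,c,d) p(c) p(d) p(a,b) / (p(c,d) p(a,c) p(b,c) p(a,d) p(b,d)))\<close>,
  and every factor except \<open>p(a,b)\<close> depends on an \<open>ACD\<close> or \<open>BCD\<close> marginal only. If
  \<open>I(A:B|C) = 0\<close> and \<open>log p(a,b)\<close> has the same expectation under \<open>p\<close> and \<open>q\<close>, the expression is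
  therefore the Kullback-Leibler divergence of \<open>q\<close> from the subprobability
  \<open>p(a,d) p(b,d) / p(d) \<cdot> p(a,b,c) / p(a,b)\<close>, hence nonnegative. The two expectations agree
  because \<open>p(a,b) = p(a) p(b)\<close> in the first case, \<open>p\<close> and \<open>q\<close> have the same \<open>ABC\<close> marginal in the
  second, and \<open>p(a,b) = p(a,c) p(b,c) / p(c)\<close> on both supports in the third.
\<close>

section \<open>Gibbs' inequality and its equality case\<close>

text \<open>This is the tangent bound \<open>ln x \<le> x - 1\<close> at \<open>x = q / p\<close>,
  multiplied by \<open>p\<close>; the bound is attained only at \<open>x = 1\<close>. For
  \<open>p = 0\<close> the left side is 0 while the right side is \<open>- q / ln b\<close>, so
  equality again forces \<open>p = q\<close>.\<close>

lemma gibbs_term: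
  fixes p q b :: real
  assumes "b > 1" "p \<ge> 0" "q \<ge> 0" "p > 0 \<Longrightarrow> q > 0"
  shows "p * log b (p / q) \<ge> (p - q) / ln b"
    and "p * log b (p / q) = (p - q) / ln b \<Longrightarrow> p = q"
proof -
  have lb: "ln b > 0" using assms by simp
  have "p * ln (p / q) \<ge> p - q \<and> (p * ln (p / q) = p - q \<longrightarrow> p = q)"
  proof (cases "p = 0")
    case False
    then have p: "p > 0" "q > 0" using assms by auto
    have "ln (p / q) = - ln (q / p)" using p by (simp add: ln_div)
    moreover have "ln (q / p) \<le> q / p - 1" using p by (simp add: ln_le_minus_one)
    moreover have "p * (q / p - 1) = q - p" using p by (simp add: field_simps)
    ultimately have 1: "p * ln (p / q) \<ge> p - q"
      using mult_left_mono[of "ln (q / p)" "q / p - 1" p] p by simp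
    have "p = q" if "p * ln (p / q) = p - q"
    proof -
      have "p * ln (q / p) = p * (q / p - 1)"
        using that \<open>ln (p / q) = - ln (q / p)\<close> \<open>p * (q / p - 1) = q - p\<close> by simp
      then have "ln (q / p) = q / p - 1" using p by simp
      then have "q / p = 1" using p ln_eq_minus_one[of "q / p"] by simp
      then show ?thesis using p by simp
    qed
    with 1 show ?thesis by blast
  qed (use assms in auto)
  then show "p * log b (p / q) \<ge> (p - q) / ln b"
    and "p * log b (p / q) = (p - q) / ln b \<Longrightarrow> p = q"
    using lb by (auto simp: log_def divide_simps)
qed

text \<open>Summing \<open>gibbs_term\<close> leaves the lower bound
  \<open>(sum p I - sum q I) / ln b\<close>. Only \<open>sum q I \<le> sum p I\<close> enters, so
  \<open>q\<close> may be a subprobability.\<close>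

lemma gibbs_inequality:
  fixes p q :: "'i \<Rightarrow> real"
  assumes b: "b > 1"
    and pq: "\<And>i. i \<in> I \<Longrightarrow> p i \<ge> 0" "\<And>i. i \<in> I \<Longrightarrow> q i \<ge> 0"
      "\<And>i. i \<in> I \<Longrightarrow> p i > 0 \<Longrightarrow> q i > 0"
    and le: "sum q I \<le> sum p I"
  shows "(\<Sum>i\<in>I. p i * log b (p i / q i)) \<ge> 0"
proof -
  have "0 \<le> (\<Sum>i\<in>I. (p i - q i) / ln b)"
    using b le by (simp flip: sum_divide_distrib add: sum_subtractf)
  also have "\<dots> \<le> (\<Sum>i\<in>I. p i * log b (p i / q i))"
    by (intro sum_mono gibbs_term(1) b pq)
  finally show ?thesis .
qed

text \<open>The slacks in \<open>gibbs_term\<close> are nonnegative and their sum is at most 0, so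
  each of them vanishes and the equality case applies at every index.\<close>

lemma gibbs_equality:
  fixes p q :: "'i \<Rightarrow> real"
  assumes b: "b > 1" and I: "finite I"
    and pq: "\<And>i. i \<in> I \<Longrightarrow> p i \<ge> 0" "\<And>i. i \<in> I \<Longrightarrow> q i \<ge> 0"
      "\<And>i. i \<in> I \<Longrightarrow> p i > 0 \<Longrightarrow> q i > 0"
    and le: "sum q I \<le> sum p I"
    and eq: "(\<Sum>i\<in>I. p i * log b (p i / q i)) = 0"
    and i: "i \<in> I"
  shows "p i = q i"
proof -
  have "0 \<le> (\<Sum>i\<in>I. (p i - q i) / ln b)"
    using b le by (simp flip: sum_divide_distrib add: sum_subtractf)
  then have "(\<Sum>i\<in>I. p i * log b (p i / q i) - (p i - q i) / ln b) \<le> 0"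
    using eq by (simp add: sum_subtractf)
  moreover have nn: "p i * log b (p i / q i) - (p i - q i) / ln b \<ge> 0" if "i \<in> I" for i
    using gibbs_term(1)[OF b pq[OF that]] that by simp
  ultimately have "(\<Sum>i\<in>I. p i * log b (p i / q i) - (p i - q i) / ln b) = 0"
    by (intro antisym sum_nonneg) auto
  then have "p i * log b (p i / q i) - (p i - q i) / ln b = 0"
    using sum_nonneg_eq_0_iff[OF I nn] i by simp
  then show ?thesis
    using gibbs_term(2)[OF b pq[OF i]] i by simp
qed

section \<open>Point masses and entropies as sums over a joint law\<close>

context information_space
begin

definition pmass :: "('a \<Rightarrow> 'x) \<Rightarrow> 'x \<Rightarrow> real" where
  "pmass X x = prob {\<omega> \<in> space M. X \<omega> = x}"

lemma pmass_nonneg [simp]: "pmass X x \<ge> 0"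
  by (simp add: pmass_def)

lemma pmass_cong: "(\<And>\<omega>. X \<omega> = x \<longleftrightarrow> Y \<omega> = y) \<Longrightarrow> pmass X x = pmass Y y"
  by (simp add: pmass_def)

lemma pmass_outside: "x \<notin> X ` space M \<Longrightarrow> pmass X x = 0"
proof -
  assume "x \<notin> X ` space M"
  then have "{\<omega> \<in> space M. X \<omega> = x} = {}" by auto
  then show ?thesis unfolding pmass_def by (metis measure_empty)
qed

lemma simple_function_level_set:
  assumes "simple_function M X"
  shows "{\<omega> \<in> space M. X \<omega> = x} \<in> events"
proof -
  have "{\<omega> \<in> space M. X \<omega> = x} = X -` {x} \<inter> space M" by auto
  then show ?thesis using simple_functionD(2)[OF assms, of "{x}"] by simp
qed

text \<open>The event \<open>Z = z y\<close> only has to be the intersection of \<open>X = x\<close>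
  and \<open>Y = y\<close>. One lemma thus sums out a coordinate at any position of a tuple.\<close>

lemma pmass_marginal:
  assumes X: "simple_function M X" and Y: "simple_function M Y"
    and Z: "\<And>\<omega> y. Z \<omega> = z y \<longleftrightarrow> X \<omega> = x \<and> Y \<omega> = y"
  shows "(\<Sum>y\<in>Y ` space M. pmass Z (z y)) = pmass X x"
proof -
  have ev: "{\<omega> \<in> space M. Z \<omega> = z y} \<in> events" for y
  proof -
    have "{\<omega> \<in> space M. Z \<omega> = z y} = {\<omega> \<in> space M. X \<omega> = x} \<inter> {\<omega> \<in> space M. Y \<omega> = y}"
      using Z by auto
    then show ?thesis by (simp add: sets.Int simple_function_level_set X Y)
  qed
  have "pmass X x = prob (\<Union>y\<in>Y ` space M. {\<omega> \<in> space M. Z \<omega> = z y})"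
    unfolding pmass_def by (rule arg_cong[where f = prob]) (auto simp: Z)
  also have "\<dots> = (\<Sum>y\<in>Y ` space M. prob {\<omega> \<in> space M. Z \<omega> = z y})"
    by (rule finite_measure_finite_Union)
       (use ev in \<open>auto simp: simple_functionD(1)[OF Y] disjoint_family_on_def Z\<close>)
  finally show ?thesis by (simp add: pmass_def)
qed

lemma pmass_mono:
  assumes "simple_function M Y" "\<And>\<omega>. X \<omega> = x \<Longrightarrow> Y \<omega> = y"
  shows "pmass X x \<le> pmass Y y"
  unfolding pmass_def
  by (rule finite_measure_mono) (auto simp: assms simple_function_level_set)

lemma pmass_pos_mono:
  assumes "pmass X x > 0" "simple_function M Y" "\<And>\<omega>. X \<omega> = x \<Longrightarrow> Y \<omega> = y"
  shows "pmass Y y > 0"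
  using pmass_mono[of Y X x y, OF assms(2) assms(3)] assms(1) by linarith

lemma pmass_eq_0_mono:
  assumes "pmass Y y = 0" "simple_function M Y" "\<And>\<omega>. X \<omega> = x \<Longrightarrow> Y \<omega> = y"
  shows "pmass X x = 0"
  using pmass_mono[of Y X x y, OF assms(2) assms(3)] assms(1) pmass_nonneg[of X x] by linarith

lemma sum_pmass:
  assumes "simple_function M X"
  shows "(\<Sum>x\<in>X ` space M. pmass X x) = 1"
proof -
  \<comment> \<open>The total mass is the marginal belonging to a constant variable.\<close>
  have "(\<Sum>x\<in>X ` space M. pmass X x) = pmass (\<lambda>_. ()) ()"
    by (rule pmass_marginal) (use assms in auto)
  then show ?thesis by (simp add: pmass_def prob_space)
qed

text \<open>Each mass of \<open>X\<close> is the sum of the masses of \<open>W\<close> over a fibre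
  of \<open>f\<close>. All entropies of functions of \<open>W\<close> become sums over one index set
  with the same weights, so linear combinations of them merge into one sum. Points of
  \<open>T\<close> outside the range of \<open>W\<close> have weight 0.\<close>

lemma shannon_entropy_eq_joint_sum:
  assumes W: "simple_function M W" and T: "finite T" "W ` space M \<subseteq> T"
    and X: "X = (\<lambda>\<omega>. f (W \<omega>))"
  shows "shannon_entropy b M X = - (\<Sum>w\<in>T. pmass W w * log b (pmass X (f w)))"
proof -
  have sX: "simple_function M X"
    unfolding X using simple_function_compose1[OF W] .
  have fin: "finite (W ` space M)" using W by (rule simple_functionD(1))
  have XW: "X ` space M = f ` (W ` space M)" using X by auto
  have marg: "pmass X x = (\<Sum>w | w \<in> W ` space M \<and> f w = x. pmass W w)" for x
  proof -
    have "pmass X x = (\<Sum>w\<in>W ` space M. pmass (\<lambda>\<omega>. (X \<omega>, W \<omega>)) (x, w))"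
      by (rule pmass_marginal[symmetric]) (use sX W in auto)
    also have "\<dots> = (\<Sum>w | w \<in> W ` space M \<and> f w = x. pmass W w)"
    proof (rule sum.mono_neutral_cong_right)
      show "\<forall>w\<in>W ` space M - {w. w \<in> W ` space M \<and> f w = x}. pmass (\<lambda>\<omega>. (X \<omega>, W \<omega>)) (x, w) = 0"
        by (auto intro!: pmass_outside simp: X)
      show "\<And>w. w \<in> {w. w \<in> W ` space M \<and> f w = x} \<Longrightarrow> pmass (\<lambda>\<omega>. (X \<omega>, W \<omega>)) (x, w) = pmass W w"
        by (auto intro!: pmass_cong simp: X)
    qed (use fin in auto)
    finally show ?thesis .
  qed
  have "shannon_entropy b M X = - (\<Sum>x\<in>X ` space M. pmass X x * log b (pmass X x))"
    unfolding shannon_entropy_eq_sum[OF sX] pmass_def vimage_def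
    by (simp add: Int_def conj_commute)
  also have "(\<Sum>x\<in>X ` space M. pmass X x * log b (pmass X x)) =
     (\<Sum>x\<in>X ` space M. \<Sum>w | w \<in> W ` space M \<and> f w = x. pmass W w * log b (pmass X (f w)))"
    by (subst (1) marg) (auto simp: sum_distrib_right intro!: sum.cong)
  also have "\<dots> = (\<Sum>w\<in>W ` space M. pmass W w * log b (pmass X (f w)))"
    by (rule sum.group) (use fin XW in auto)
  also have "\<dots> = (\<Sum>w\<in>T. pmass W w * log b (pmass X (f w)))"
    by (rule sum.mono_neutral_left) (use T pmass_outside in auto)
  finally show ?thesis .
qed

lemma shannon_entropy_inj:
  assumes X: "simple_function M X" and f: "inj f"
  shows "shannon_entropy b M (\<lambda>\<omega>. f (X \<omega>)) = shannon_entropy b M X"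
proof -
  have fin: "finite (X ` space M)" using X by (rule simple_functionD(1))
  have "pmass (\<lambda>\<omega>. f (X \<omega>)) (f x) = pmass X x" for x
    by (rule pmass_cong) (use f in \<open>auto dest: injD\<close>)
  then show ?thesis
    using shannon_entropy_eq_joint_sum[OF X fin subset_refl refl, of f]
      shannon_entropy_eq_joint_sum[OF X fin subset_refl, of X "\<lambda>x. x"] by simp
qed

section \<open>Vanishing information quantities as identities between masses\<close>

text \<open>The conditional mutual information is the divergence of \<open>p(x,y,z)\<close> from
  \<open>p(x,z) p(y,z) / p(z)\<close>. Both have total mass 1, so \<open>gibbs_equality\<close>
  identifies them. Clearing the denominator makes the identity valid for all values, also those of
  mass 0 or outside the ranges.\<close>

lemma cond_mutual_info_eq_0D:
  assumes X: "simple_function M X" and Y: "simple_function M Y" and Z: "simple_function M Z"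
    and eq0: "cond_mutual_info b M X Y Z = 0"
  shows "pmass (\<lambda>\<omega>. (X \<omega>, Y \<omega>, Z \<omega>)) (x, y, z) * pmass Z z =
    pmass (\<lambda>\<omega>. (X \<omega>, Z \<omega>)) (x, z) * pmass (\<lambda>\<omega>. (Y \<omega>, Z \<omega>)) (y, z)"
proof -
  define XYZ where "XYZ = (\<lambda>\<omega>. (X \<omega>, Y \<omega>, Z \<omega>))"
  define XZ where "XZ = (\<lambda>\<omega>. (X \<omega>, Z \<omega>))"
  define YZ where "YZ = (\<lambda>\<omega>. (Y \<omega>, Z \<omega>))"
  note defs = XYZ_def XZ_def YZ_def
  have s: "simple_function M XYZ" "simple_function M XZ" "simple_function M YZ"
    unfolding defs using X Y Z by (auto intro!: simple_function_Pair)
  define T where "T = X ` space M \<times> Y ` space M \<times> Z ` space M"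
  have T: "finite T" "XYZ ` space M \<subseteq> T"
    using X Y Z by (auto simp: T_def defs simple_functionD(1))
  define q where "q = (\<lambda>(x, y, z). pmass XZ (x, z) * pmass YZ (y, z) / pmass Z z)"
  have pos: "pmass XZ (x, z) > 0" "pmass YZ (y, z) > 0" "pmass Z z > 0"
    if "pmass XYZ (x, y, z) > 0" for x y z
    using that by (rule pmass_pos_mono; use s Z in \<open>auto simp: defs\<close>)+
  have H: "shannon_entropy b M XYZ = - (\<Sum>w\<in>T. pmass XYZ w * log b (pmass XYZ w))"
    "shannon_entropy b M XZ = - (\<Sum>w\<in>T. pmass XYZ w * log b (pmass XZ ((\<lambda>(x, y, z). (x, z)) w)))"
    "shannon_entropy b M YZ = - (\<Sum>w\<in>T. pmass XYZ w * log b (pmass YZ ((\<lambda>(x, y, z). (y, z)) w)))"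
    "shannon_entropy b M Z = - (\<Sum>w\<in>T. pmass XYZ w * log b (pmass Z ((\<lambda>(x, y, z). z) w)))"
    by (rule shannon_entropy_eq_joint_sum[OF s(1) T]; simp add: defs)+
  have "cond_mutual_info b M X Y Z = (\<Sum>w\<in>T. pmass XYZ w * log b (pmass XYZ w / q w))"
    unfolding cond_mutual_info_def defs[symmetric] H
    unfolding sum_negf[symmetric] sum.distrib[symmetric] sum_subtractf[symmetric]
  proof (rule sum.cong[OF refl])
    fix w assume "w \<in> T"
    obtain x y z where w: "w = (x, y, z)" by (cases w)
    show "- (pmass XYZ w * log b (pmass XZ ((\<lambda>(x, y, z). (x, z)) w))) +
      - (pmass XYZ w * log b (pmass YZ ((\<lambda>(x, y, z). (y, z)) w))) -
      - (pmass XYZ w * log b (pmass XYZ w)) - - (pmass XYZ w * log b (pmass Z ((\<lambda>(x, y, z). z) w)))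
      = pmass XYZ w * log b (pmass XYZ w / q w)"
    proof (cases "pmass XYZ w > 0")
      case True
      then show ?thesis
        using pos[of x y z] by (simp add: w q_def log_divide log_mult algebra_simps)
    next
      case False
      then have "pmass XYZ w = 0" using pmass_nonneg[of XYZ w] by linarith
      then show ?thesis by simp
    qed
  qed
  then have eq: "(\<Sum>w\<in>T. pmass XYZ w * log b (pmass XYZ w / q w)) = 0"
    using eq0 by simp
  have "sum q T = (\<Sum>x\<in>X ` space M. \<Sum>y\<in>Y ` space M. \<Sum>z\<in>Z ` space M. q (x, y, z))"
    unfolding T_def by (simp add: sum.cartesian_product)
  \<comment> \<open>For fixed \<open>z\<close> the double sum over \<open>x\<close> and
    \<open>y\<close> is a product of two sums, each of them a marginal equal to
    \<open>pmass Z z\<close>.\<close>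
  also have "\<dots> = (\<Sum>z\<in>Z ` space M. (\<Sum>x\<in>X ` space M. pmass XZ (x, z)) *
      (\<Sum>y\<in>Y ` space M. pmass YZ (y, z)) / pmass Z z)"
    unfolding q_def sum_product sum_divide_distrib
    by (simp add: sum.swap[where B = "Z ` space M"])
  also have "\<dots> = (\<Sum>z\<in>Z ` space M. pmass Z z * pmass Z z / pmass Z z)"
    using X Y Z by (intro sum.cong refl arg_cong2[where f = "(/)"] arg_cong2[where f = "(*)"] pmass_marginal)
      (auto simp: defs)
  also have "\<dots> = 1"
    using sum_pmass[OF Z] by (simp cong: if_cong)
  finally have sum_q: "sum q T = 1" .
  have "sum (pmass XYZ) T = (\<Sum>w\<in>XYZ ` space M. pmass XYZ w)"
    by (rule sum.mono_neutral_right) (use T pmass_outside in auto)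
  then have sum_p: "sum (pmass XYZ) T = 1" using sum_pmass[OF s(1)] by simp
  have XYZ: "pmass XYZ (x, y, z) = q (x, y, z)" if "(x, y, z) \<in> T" for x y z
  proof (rule gibbs_equality[OF b_gt_1 T(1) _ _ _ _ eq that])
    show "0 \<le> q w" for w by (auto simp: q_def split: prod.split)
    show "0 < q w" if "pmass XYZ w > 0" for w
      using that pos by (cases w) (auto simp: q_def)
  qed (auto simp: sum_p sum_q)
  have "pmass XYZ (x, y, z) * pmass Z z = pmass XZ (x, z) * pmass YZ (y, z)"
  \<comment> \<open>Gibbs speaks only about points of \<open>T\<close>, and the denominator clears
    only where it is nonzero; in the remaining cases both sides are 0.\<close>
  proof (cases "(x, y, z) \<in> T \<and> pmass Z z \<noteq> 0")
    case True
    then show ?thesis using XYZ[of x y z] by (simp add: q_def)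
  next
    case False
    then consider "(x, y, z) \<notin> T" | "pmass Z z = 0" by blast
    then show ?thesis
    proof cases
      case 1
      then have "pmass XYZ (x, y, z) = 0" "pmass XZ (x, z) = 0 \<or> pmass YZ (y, z) = 0"
        by (auto intro!: pmass_outside simp: T_def defs image_iff)
      then show ?thesis by auto
    next
      case 2
      then have "pmass XZ (x, z) = 0"
        by (rule pmass_eq_0_mono) (auto simp: Z defs)
      then show ?thesis using 2 by simp
    qed
  qed
  then show ?thesis unfolding defs .
qed

text \<open>Conditioning on a constant changes nothing, so the factorization for the unconditional
  case follows from the conditional one.\<close>

lemma mutual_info_eq_cond_mutual_info:
  assumes X: "simple_function M X" and Y: "simple_function M Y"
  shows "mutual_info b M X Y = cond_mutual_info b M X Y (\<lambda>_. ())"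
proof -
  have XY: "simple_function M (\<lambda>\<omega>. (X \<omega>, Y \<omega>))"
    using X Y by (rule simple_function_Pair)
  have "shannon_entropy b M (\<lambda>_. ()) = 0"
    by (subst shannon_entropy_eq_sum) (auto simp: prob_space vimage_def image_constant_conv)
  moreover have "shannon_entropy b M (\<lambda>\<omega>. (X \<omega>, ())) = shannon_entropy b M X"
    by (rule shannon_entropy_inj[OF X]) (auto intro: injI)
  moreover have "shannon_entropy b M (\<lambda>\<omega>. (Y \<omega>, ())) = shannon_entropy b M Y"
    by (rule shannon_entropy_inj[OF Y]) (auto intro: injI)
  moreover have "shannon_entropy b M (\<lambda>\<omega>. (X \<omega>, Y \<omega>, ())) = shannon_entropy b M (\<lambda>\<omega>. (X \<omega>, Y \<omega>))"
    using shannon_entropy_inj[OF XY, of "\<lambda>(x, y). (x, y, ())"] by (auto simp: inj_def)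
  ultimately show ?thesis
    by (simp add: mutual_info_def cond_mutual_info_def)
qed

lemma mutual_info_eq_0D:
  assumes X: "simple_function M X" and Y: "simple_function M Y"
    and "mutual_info b M X Y = 0"
  shows "pmass (\<lambda>\<omega>. (X \<omega>, Y \<omega>)) (x, y) = pmass X x * pmass Y y"
proof -
  have "cond_mutual_info b M X Y (\<lambda>_. ()) = 0"
    using assms by (simp add: mutual_info_eq_cond_mutual_info)
  from cond_mutual_info_eq_0D[OF X Y _ this, of x y "()"]
  show ?thesis by (simp add: pmass_def prob_space)
qed

text \<open>The conditional entropy is the sum of \<open>p(x,y) (log p(y) - log p(x,y))\<close>,
  whose terms are nonnegative because \<open>p(x,y) \<le> p(y)\<close>. If the sum is 0, the two
  logarithms agree wherever \<open>p(x,y) > 0\<close>.\<close>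

lemma cond_entropy_eq_0D:
  assumes X: "simple_function M X" and Y: "simple_function M Y"
    and eq0: "cond_entropy b M X Y = 0"
    and pos: "pmass (\<lambda>\<omega>. (X \<omega>, Y \<omega>)) (x, y) > 0"
  shows "pmass (\<lambda>\<omega>. (X \<omega>, Y \<omega>)) (x, y) = pmass Y y"
proof -
  define W where "W = (\<lambda>\<omega>. (X \<omega>, Y \<omega>))"
  have W: "simple_function M W" unfolding W_def using X Y by (rule simple_function_Pair)
  have fin: "finite (W ` space M)" using W by (rule simple_functionD(1))
  have le: "pmass W w \<le> pmass Y (snd w)" for w
    by (rule pmass_mono) (auto simp: Y W_def)
  have H: "shannon_entropy b M W = - (\<Sum>w\<in>W ` space M. pmass W w * log b (pmass W w))"
    "shannon_entropy b M Y = - (\<Sum>w\<in>W ` space M. pmass W w * log b (pmass Y (snd w)))"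
    by (rule shannon_entropy_eq_joint_sum[OF W fin subset_refl]; simp add: W_def)+
  have nn: "pmass W w * (log b (pmass Y (snd w)) - log b (pmass W w)) \<ge> 0" for w
  proof (cases "pmass W w > 0")
    case True
    then show ?thesis using le[of w] b_gt_1 by simp
  next
    case False
    then have "pmass W w = 0" using pmass_nonneg[of W w] by linarith
    then show ?thesis by simp
  qed
  have "(\<Sum>w\<in>W ` space M. pmass W w * (log b (pmass Y (snd w)) - log b (pmass W w))) = 0"
    using eq0 unfolding cond_entropy_def W_def[symmetric] H
    by (simp add: right_diff_distrib sum_subtractf)
  then have zero: "\<forall>w\<in>W ` space M. pmass W w * (log b (pmass Y (snd w)) - log b (pmass W w)) = 0"
    using sum_nonneg_eq_0_iff[OF fin, of "\<lambda>w. pmass W w * (log b (pmass Y (snd w)) - log b (pmass W w))"] nn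
    by simp
  have "(x, y) \<in> W ` space M"
    using pos pmass_outside[of "(x, y)" W] unfolding W_def[symmetric] by auto
  from bspec[OF zero this] have "log b (pmass Y y) = log b (pmass W (x, y))"
    using pos unfolding W_def[symmetric] by simp
  moreover have "pmass Y y > 0" using le[of "(x, y)"] pos unfolding W_def by simp
  ultimately show ?thesis
    using pos b_gt_1 unfolding W_def[symmetric] by (auto simp: log_def)
qed

end

section \<open>Four variables and the coupling of the \<open>ACD\<close> and \<open>BCD\<close>
  marginals\<close>

locale four_variables = information_space M b for M :: "'w measure" and b :: real +
  fixes A :: "'w \<Rightarrow> 'a" and B :: "'w \<Rightarrow> 'b" and C :: "'w \<Rightarrow> 'c" and D :: "'w \<Rightarrow> 'd"
  assumes simple [simp]: "simple_function M A" "simple_function M B"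
    "simple_function M C" "simple_function M D"
begin

abbreviation "RA \<equiv> A ` space M"
abbreviation "RB \<equiv> B ` space M"
abbreviation "RC \<equiv> C ` space M"
abbreviation "RD \<equiv> D ` space M"

abbreviation "pA \<equiv> pmass A"
abbreviation "pB \<equiv> pmass B"
abbreviation "pC \<equiv> pmass C"
abbreviation "pD \<equiv> pmass D"
abbreviation "pAB i j \<equiv> pmass (\<lambda>\<omega>. (A \<omega>, B \<omega>)) (i, j)"
abbreviation "pAC i k \<equiv> pmass (\<lambda>\<omega>. (A \<omega>, C \<omega>)) (i, k)"
abbreviation "pAD i l \<equiv> pmass (\<lambda>\<omega>. (A \<omega>, D \<omega>)) (i, l)"
abbreviation "pBC j k \<equiv> pmass (\<lambda>\<omega>. (B \<omega>, C \<omega>)) (j, k)"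
abbreviation "pBD j l \<equiv> pmass (\<lambda>\<omega>. (B \<omega>, D \<omega>)) (j, l)"
abbreviation "pCD k l \<equiv> pmass (\<lambda>\<omega>. (C \<omega>, D \<omega>)) (k, l)"
abbreviation "pABC i j k \<equiv> pmass (\<lambda>\<omega>. (A \<omega>, B \<omega>, C \<omega>)) (i, j, k)"
abbreviation "pACD i k l \<equiv> pmass (\<lambda>\<omega>. (A \<omega>, C \<omega>, D \<omega>)) (i, k, l)"
abbreviation "pBCD j k l \<equiv> pmass (\<lambda>\<omega>. (B \<omega>, C \<omega>, D \<omega>)) (j, k, l)"
abbreviation "pABCD i j k l \<equiv> pmass (\<lambda>\<omega>. (A \<omega>, B \<omega>, C \<omega>, D \<omega>)) (i, j, k, l)"

definition joint_sum :: "('a \<Rightarrow> 'b \<Rightarrow> 'c \<Rightarrow> 'd \<Rightarrow> real) \<Rightarrow> real" where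
  "joint_sum f = (\<Sum>i\<in>RA. \<Sum>j\<in>RB. \<Sum>k\<in>RC. \<Sum>l\<in>RD. f i j k l)"

text \<open>The law \<open>q\<close> of the opening comment. Where \<open>pCD k l = 0\<close>,
  division by zero gives the value 0, in accordance with \<open>pACD i k l = 0\<close>.\<close>

definition coupling :: "'a \<Rightarrow> 'b \<Rightarrow> 'c \<Rightarrow> 'd \<Rightarrow> real" where
  "coupling i j k l = pACD i k l * pBCD j k l / pCD k l"

lemma coupling_nonneg: "coupling i j k l \<ge> 0"
  by (simp add: coupling_def)

lemma simple_tuples [simp]:
  "simple_function M (\<lambda>\<omega>. (A \<omega>, B \<omega>))" "simple_function M (\<lambda>\<omega>. (A \<omega>, C \<omega>))"
  "simple_function M (\<lambda>\<omega>. (A \<omega>, D \<omega>))" "simple_function M (\<lambda>\<omega>. (B \<omega>, C \<omega>))"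
  "simple_function M (\<lambda>\<omega>. (B \<omega>, D \<omega>))" "simple_function M (\<lambda>\<omega>. (C \<omega>, D \<omega>))"
  "simple_function M (\<lambda>\<omega>. (A \<omega>, B \<omega>, C \<omega>))" "simple_function M (\<lambda>\<omega>. (A \<omega>, C \<omega>, D \<omega>))"
  "simple_function M (\<lambda>\<omega>. (B \<omega>, C \<omega>, D \<omega>))"
  "simple_function M (\<lambda>\<omega>. (A \<omega>, B \<omega>, C \<omega>, D \<omega>))"
  by (simp_all add: simple_function_Pair)

lemma joint_sum_eq_sum_prod:
  "joint_sum f = (\<Sum>(i, j, k, l)\<in>RA \<times> RB \<times> RC \<times> RD. f i j k l)"
  by (simp add: joint_sum_def sum.cartesian_product)

lemma joint_sum_add: "joint_sum (\<lambda>i j k l. f i j k l + g i j k l) = joint_sum f + joint_sum g"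
  by (simp add: joint_sum_def sum.distrib)

lemma joint_sum_diff: "joint_sum (\<lambda>i j k l. f i j k l - g i j k l) = joint_sum f - joint_sum g"
  by (simp add: joint_sum_def sum_subtractf)

lemma joint_sum_cong: "(\<And>i j k l. f i j k l = g i j k l) \<Longrightarrow> joint_sum f = joint_sum g"
  by (simp add: joint_sum_def)

lemma shannon_entropy_eq_sum_ABCD:
  assumes "X = (\<lambda>\<omega>. f (A \<omega>, B \<omega>, C \<omega>, D \<omega>))"
    and g: "\<And>i j k l. pmass X (f (i, j, k, l)) = g i j k l"
  shows "shannon_entropy b M X = - joint_sum (\<lambda>i j k l. pABCD i j k l * log b (g i j k l))"
proof -
  have "shannon_entropy b M X = - (\<Sum>w\<in>RA \<times> RB \<times> RC \<times> RD.
      pmass (\<lambda>\<omega>. (A \<omega>, B \<omega>, C \<omega>, D \<omega>)) w * log b (pmass X (f w)))"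
    by (rule shannon_entropy_eq_joint_sum[where f = f])
      (use assms(1) in \<open>auto intro!: finite_cartesian_product simple_functionD(1)\<close>)
  also have "\<dots> = - joint_sum (\<lambda>i j k l. pABCD i j k l * log b (g i j k l))"
    by (auto simp: joint_sum_eq_sum_prod g intro!: sum.cong)
  finally show ?thesis .
qed

text \<open>Summing out \<open>j\<close> turns \<open>pBCD\<close> into \<open>pCD\<close>, which
  cancels the denominator; where \<open>pCD\<close> is 0, so is \<open>pACD\<close>.\<close>

lemma coupling_marginal_B: "(\<Sum>j\<in>RB. coupling i j k l) = pACD i k l"
proof -
  have "(\<Sum>j\<in>RB. coupling i j k l) = pACD i k l * (\<Sum>j\<in>RB. pBCD j k l) / pCD k l"
    by (simp add: coupling_def sum_distrib_left sum_divide_distrib)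
  also have "(\<Sum>j\<in>RB. pBCD j k l) = pCD k l"
    by (rule pmass_marginal) auto
  also have "pACD i k l * pCD k l / pCD k l = pACD i k l"
  proof (cases "pCD k l = 0")
    case True
    then have "pACD i k l = 0" by (rule pmass_eq_0_mono) simp_all
    then show ?thesis by simp
  qed simp
  finally show ?thesis .
qed

lemma coupling_marginal_A: "(\<Sum>i\<in>RA. coupling i j k l) = pBCD j k l"
proof -
  have "(\<Sum>i\<in>RA. coupling i j k l) = (\<Sum>i\<in>RA. pACD i k l) * pBCD j k l / pCD k l"
    by (simp add: coupling_def sum_distrib_right sum_divide_distrib)
  also have "(\<Sum>i\<in>RA. pACD i k l) = pCD k l"
    by (rule pmass_marginal) auto
  also have "pCD k l * pBCD j k l / pCD k l = pBCD j k l"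
  proof (cases "pCD k l = 0")
    case True
    then have "pBCD j k l = 0" by (rule pmass_eq_0_mono) simp_all
    then show ?thesis by simp
  qed simp
  finally show ?thesis .
qed

text \<open>The expectation of a function of \<open>(i, k, l)\<close> depends only on the
  \<open>ACD\<close> marginal, which both laws share. This and its \<open>BCD\<close> counterpart
  move logarithms from \<open>pABCD\<close> to \<open>coupling\<close>.\<close>

lemma joint_sum_coupling_ACD:
  "joint_sum (\<lambda>i j k l. coupling i j k l * g i k l) = joint_sum (\<lambda>i j k l. pABCD i j k l * g i k l)"
proof -
  \<comment> \<open>The weight \<open>h\<close> is left arbitrary so that the rearrangement serves
    both laws.\<close>
  have *: "joint_sum (\<lambda>i j k l. h i j k l * g i k l) =
      (\<Sum>i\<in>RA. \<Sum>k\<in>RC. \<Sum>l\<in>RD. (\<Sum>j\<in>RB. h i j k l) * g i k l)" for h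
    unfolding joint_sum_def sum_distrib_right by (simp add: sum.swap[where A = RB])
  have "(\<Sum>j\<in>RB. pABCD i j k l) = pACD i k l" for i k l
    by (rule pmass_marginal) auto
  then show ?thesis by (simp add: * coupling_marginal_B)
qed

lemma joint_sum_coupling_BCD:
  "joint_sum (\<lambda>i j k l. coupling i j k l * g j k l) = joint_sum (\<lambda>i j k l. pABCD i j k l * g j k l)"
proof -
  have *: "joint_sum (\<lambda>i j k l. h i j k l * g j k l) =
      (\<Sum>j\<in>RB. \<Sum>k\<in>RC. \<Sum>l\<in>RD. (\<Sum>i\<in>RA. h i j k l) * g j k l)" for h
    unfolding joint_sum_def sum_distrib_right by (simp add: sum.swap[where A = RA])
  have "(\<Sum>i\<in>RA. pABCD i j k l) = pBCD j k l" for j k l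
    by (rule pmass_marginal) auto
  then show ?thesis by (simp add: * coupling_marginal_A)
qed

lemma joint_sum_coupling: "joint_sum coupling = 1"
proof -
  have "joint_sum (\<lambda>i j k l. coupling i j k l * 1) = (\<Sum>w\<in>RA \<times> RB \<times> RC \<times> RD.
      pmass (\<lambda>\<omega>. (A \<omega>, B \<omega>, C \<omega>, D \<omega>)) w)"
    by (simp only: joint_sum_coupling_ACD) (auto simp: joint_sum_eq_sum_prod intro!: sum.cong)
  also have "\<dots> = (\<Sum>w\<in>(\<lambda>\<omega>. (A \<omega>, B \<omega>, C \<omega>, D \<omega>)) ` space M.
      pmass (\<lambda>\<omega>. (A \<omega>, B \<omega>, C \<omega>, D \<omega>)) w)"
    by (rule sum.mono_neutral_right)
      (auto intro!: finite_cartesian_product simple_functionD(1) pmass_outside)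
  also have "\<dots> = 1" by (rule sum_pmass) simp
  finally show ?thesis by simp
qed

section \<open>The reference subprobability\<close>

text \<open>Draw \<open>D\<close>, then \<open>A\<close> and \<open>B\<close> independently given
  \<open>D\<close>, then \<open>C\<close> from its conditional law given \<open>(A, B)\<close>. Mass
  is lost at pairs with \<open>pAB i j = 0\<close>, where the last factor is 0 by the convention for
  division.\<close>

definition reference :: "'a \<Rightarrow> 'b \<Rightarrow> 'c \<Rightarrow> 'd \<Rightarrow> real" where
  "reference i j k l = pAD i l * pBD j l / pD l * (pABC i j k / pAB i j)"

lemma reference_nonneg: "reference i j k l \<ge> 0"
  by (simp add: reference_def)

lemma joint_sum_reference_le: "joint_sum reference \<le> 1"
proof -
  have "joint_sum reference =
      (\<Sum>i\<in>RA. \<Sum>j\<in>RB. \<Sum>l\<in>RD. pAD i l * pBD j l / pD l * ((\<Sum>k\<in>RC. pABC i j k) / pAB i j))"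
    unfolding joint_sum_def reference_def sum_distrib_left sum_divide_distrib
    by (simp add: sum.swap[where A = RC])
  also have "\<dots> \<le> (\<Sum>i\<in>RA. \<Sum>j\<in>RB. \<Sum>l\<in>RD. pAD i l * pBD j l / pD l * 1)"
  proof (intro sum_mono mult_left_mono)
    fix i j
    have "(\<Sum>k\<in>RC. pABC i j k) = pAB i j"
      by (rule pmass_marginal) auto
    \<comment> \<open>The quotient is 1, or 0 where \<open>pAB i j = 0\<close>; hence only an
      inequality.\<close>
    then show "(\<Sum>k\<in>RC. pABC i j k) / pAB i j \<le> 1" by simp
  qed simp
  also have "\<dots> = (\<Sum>l\<in>RD. (\<Sum>i\<in>RA. pAD i l) * (\<Sum>j\<in>RB. pBD j l) / pD l)"
    unfolding sum_product sum_divide_distrib by (simp add: sum.swap[where B = RD])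
  also have "\<dots> = (\<Sum>l\<in>RD. pD l * pD l / pD l)"
    by (intro sum.cong refl arg_cong2[where f = "(/)"] arg_cong2[where f = "(*)"] pmass_marginal) auto
  also have "\<dots> = 1"
    using sum_pmass[OF simple(4)] by (simp cong: if_cong)
  finally show ?thesis .
qed

text \<open>The entropies of \<open>A\<close> and of \<open>B\<close> alone cancel. The remaining
  terms are grouped for the transfer to \<open>coupling\<close>: functions of
  \<open>(i, k, l)\<close>, functions of \<open>(j, k, l)\<close>, and the exceptional term
  \<open>log b (pAB i j)\<close>.\<close>

lemma ingleton_eq_joint_sum:
  "ingleton b M A B C D = joint_sum (\<lambda>i j k l. pABCD i j k l *
     ((log b (pACD i k l) - log b (pCD k l) + log b (pC k) + log b (pD l)
        - log b (pAC i k) - log b (pAD i l))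
      + (log b (pBCD j k l) - log b (pBC j k) - log b (pBD j l))
      + log b (pAB i j)))"
proof -
  note H = shannon_entropy_eq_sum_ABCD
  have "shannon_entropy b M A = - joint_sum (\<lambda>i j k l. pABCD i j k l * log b (pA i))"
    by (rule H[where f = "\<lambda>(i, j, k, l). i"]) auto
  moreover have "shannon_entropy b M B = - joint_sum (\<lambda>i j k l. pABCD i j k l * log b (pB j))"
    by (rule H[where f = "\<lambda>(i, j, k, l). j"]) auto
  moreover have "shannon_entropy b M C = - joint_sum (\<lambda>i j k l. pABCD i j k l * log b (pC k))"
    by (rule H[where f = "\<lambda>(i, j, k, l). k"]) auto
  moreover have "shannon_entropy b M D = - joint_sum (\<lambda>i j k l. pABCD i j k l * log b (pD l))"
    by (rule H[where f = "\<lambda>(i, j, k, l). l"]) auto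
  moreover have "shannon_entropy b M (\<lambda>\<omega>. (A \<omega>, B \<omega>)) =
      - joint_sum (\<lambda>i j k l. pABCD i j k l * log b (pAB i j))"
    by (rule H[where f = "\<lambda>(i, j, k, l). (i, j)"]) auto
  moreover have "shannon_entropy b M (\<lambda>\<omega>. (C \<omega>, A \<omega>)) =
      - joint_sum (\<lambda>i j k l. pABCD i j k l * log b (pAC i k))"
    by (rule H[where f = "\<lambda>(i, j, k, l). (k, i)"]) (auto intro: pmass_cong)
  moreover have "shannon_entropy b M (\<lambda>\<omega>. (D \<omega>, A \<omega>)) =
      - joint_sum (\<lambda>i j k l. pABCD i j k l * log b (pAD i l))"
    by (rule H[where f = "\<lambda>(i, j, k, l). (l, i)"]) (auto intro: pmass_cong)
  moreover have "shannon_entropy b M (\<lambda>\<omega>. (C \<omega>, B \<omega>)) =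
      - joint_sum (\<lambda>i j k l. pABCD i j k l * log b (pBC j k))"
    by (rule H[where f = "\<lambda>(i, j, k, l). (k, j)"]) (auto intro: pmass_cong)
  moreover have "shannon_entropy b M (\<lambda>\<omega>. (D \<omega>, B \<omega>)) =
      - joint_sum (\<lambda>i j k l. pABCD i j k l * log b (pBD j l))"
    by (rule H[where f = "\<lambda>(i, j, k, l). (l, j)"]) (auto intro: pmass_cong)
  moreover have "shannon_entropy b M (\<lambda>\<omega>. (C \<omega>, D \<omega>)) =
      - joint_sum (\<lambda>i j k l. pABCD i j k l * log b (pCD k l))"
    by (rule H[where f = "\<lambda>(i, j, k, l). (k, l)"]) auto
  moreover have "shannon_entropy b M (\<lambda>\<omega>. (C \<omega>, D \<omega>, A \<omega>)) =
      - joint_sum (\<lambda>i j k l. pABCD i j k l * log b (pACD i k l))"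
    by (rule H[where f = "\<lambda>(i, j, k, l). (k, l, i)"]) (auto intro: pmass_cong)
  moreover have "shannon_entropy b M (\<lambda>\<omega>. (C \<omega>, D \<omega>, B \<omega>)) =
      - joint_sum (\<lambda>i j k l. pABCD i j k l * log b (pBCD j k l))"
    by (rule H[where f = "\<lambda>(i, j, k, l). (k, l, j)"]) (auto intro: pmass_cong)
  ultimately show ?thesis
    unfolding ingleton_def cond_mutual_info_def mutual_info_def
    by (simp only: distrib_left right_diff_distrib joint_sum_add joint_sum_diff)
qed

lemma BD_cond_independentI:
  assumes "cond_mutual_info b M B D C = 0"
  shows "pBCD j k l * pC k = pBC j k * pCD k l"
proof -
  have "pmass (\<lambda>\<omega>. (B \<omega>, D \<omega>, C \<omega>)) (j, l, k) = pBCD j k l"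
    "pmass (\<lambda>\<omega>. (D \<omega>, C \<omega>)) (l, k) = pCD k l"
    by (auto intro: pmass_cong)
  then show ?thesis
    using cond_mutual_info_eq_0D[OF simple(2,4,3) assms, of j l k] by simp
qed

lemma determinedI:
  assumes "cond_entropy b M C (\<lambda>\<omega>. (A \<omega>, B \<omega>)) = 0" "pABC i j k > 0"
  shows "pABC i j k = pAB i j"
proof -
  have "pmass (\<lambda>\<omega>. (C \<omega>, A \<omega>, B \<omega>)) (k, i, j) = pABC i j k"
    by (auto intro: pmass_cong)
  then show ?thesis
    using cond_entropy_eq_0D[OF simple(3) simple_tuples(1) assms(1), of k "(i, j)"] assms(2)
    by simp
qed

section \<open>Nonnegativity when \<open>A\<close> and \<open>B\<close> are independent given
  \<open>C\<close>\<close>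

context
  assumes AB_indep_C: "\<And>i j k. pABC i j k * pC k = pAC i k * pBC j k"
begin

lemma coupling_pos_marginals:
  assumes "coupling i j k l > 0"
  shows "pACD i k l > 0" "pBCD j k l > 0" "pCD k l > 0" "pAC i k > 0" "pBC j k > 0"
    "pAD i l > 0" "pBD j l > 0" "pC k > 0" "pD l > 0" "pABC i j k > 0" "pAB i j > 0"
proof -
  have "pACD i k l \<noteq> 0" "pBCD j k l \<noteq> 0"
    using assms by (auto simp: coupling_def)
  then show 1: "pACD i k l > 0" "pBCD j k l > 0"
    by (simp_all add: order.strict_iff_order)
  show 2: "pCD k l > 0" "pAC i k > 0" "pAD i l > 0" "pC k > 0" "pD l > 0"
    using 1(1) by (rule pmass_pos_mono; simp)+
  show 3: "pBC j k > 0" "pBD j l > 0"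
    using 1(2) by (rule pmass_pos_mono; simp)+
  \<comment> \<open>Here conditional independence is essential: it makes \<open>pABC\<close>, hence
    \<open>pAB\<close> and \<open>reference\<close>, positive on the support of
    \<open>coupling\<close>, as Gibbs' inequality requires.\<close>
  have "pABC i j k \<noteq> 0"
    using AB_indep_C[of i j k] 2 3 by auto
  then show "pABC i j k > 0"
    by (simp add: order.strict_iff_order)
  then show "pAB i j > 0"
    by (rule pmass_pos_mono) simp_all
qed

text \<open>The assumption transfers the one term that the marginals do not. What remains is the
  divergence of \<open>coupling\<close> from \<open>reference\<close>.\<close>

lemma ingleton_nonneg_if_coupling:
  assumes "joint_sum (\<lambda>i j k l. coupling i j k l * log b (pAB i j)) =
    joint_sum (\<lambda>i j k l. pABCD i j k l * log b (pAB i j))"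
  shows "ingleton b M A B C D \<ge> 0"
proof -
  let ?F = "\<lambda>i k l. log b (pACD i k l) - log b (pCD k l) + log b (pC k) + log b (pD l)
        - log b (pAC i k) - log b (pAD i l)"
  let ?G = "\<lambda>j k l. log b (pBCD j k l) - log b (pBC j k) - log b (pBD j l)"
  have "ingleton b M A B C D = joint_sum (\<lambda>i j k l. coupling i j k l * (?F i k l + ?G j k l + log b (pAB i j)))"
    unfolding ingleton_eq_joint_sum
    using joint_sum_coupling_ACD[of ?F] joint_sum_coupling_BCD[of ?G] assms
    by (simp only: distrib_left[where b = "_ + _"] distrib_left[where b = "?F _ _ _"] joint_sum_add)
  also have "\<dots> = joint_sum (\<lambda>i j k l. coupling i j k l * log b (coupling i j k l / reference i j k l))"
  proof (rule joint_sum_cong)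
    fix i j k l
    show "coupling i j k l * (?F i k l + ?G j k l + log b (pAB i j)) =
      coupling i j k l * log b (coupling i j k l / reference i j k l)"
    proof (cases "coupling i j k l > 0")
      case True
      note pos = coupling_pos_marginals[OF True]
      \<comment> \<open>This turns the factor \<open>pABC\<close> of \<open>reference\<close> into
        the marginals that occur in the integrand.\<close>
      have ABC: "pABC i j k = pAC i k * pBC j k / pC k"
        using AB_indep_C[of i j k] pos by (simp add: field_simps)
      show ?thesis
        unfolding coupling_def reference_def ABC using pos
        by (simp add: log_divide log_mult algebra_simps)
    next
      case False
      then have "coupling i j k l = 0" using coupling_nonneg[of i j k l] by linarith
      then show ?thesis by simp
    qed
  qed
  also have "\<dots> \<ge> 0"
  proof -
    have "0 \<le> (\<Sum>w\<in>RA \<times> RB \<times> RC \<times> RD. (\<lambda>(i, j, k, l). coupling i j k l) w *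
        log b ((\<lambda>(i, j, k, l). coupling i j k l) w / (\<lambda>(i, j, k, l). reference i j k l) w))"
    proof (rule gibbs_inequality[OF b_gt_1])
      show "(\<lambda>(i, j, k, l). reference i j k l) w > 0" if "(\<lambda>(i, j, k, l). coupling i j k l) w > 0" for w
        using that coupling_pos_marginals by (cases w) (simp add: reference_def)
      show "(\<Sum>(i, j, k, l)\<in>RA \<times> RB \<times> RC \<times> RD. reference i j k l)
        \<le> (\<Sum>(i, j, k, l)\<in>RA \<times> RB \<times> RC \<times> RD. coupling i j k l)"
        unfolding joint_sum_eq_sum_prod[symmetric] joint_sum_coupling by (rule joint_sum_reference_le)
    qed (auto simp: coupling_nonneg reference_nonneg)
    then show ?thesis by (simp add: joint_sum_eq_sum_prod case_prod_unfold)
  qed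
  finally show ?thesis .
qed

text \<open>Now \<open>log b (pAB i j)\<close> splits into a function of \<open>i\<close> and a
  function of \<open>j\<close>, and each transfers through its marginal.\<close>

lemma ingleton_nonneg_if_independent:
  assumes AB: "\<And>i j. pAB i j = pA i * pB j"
  shows "ingleton b M A B C D \<ge> 0"
proof (rule ingleton_nonneg_if_coupling)
  \<comment> \<open>The product rule for logarithms needs positive factors; the weight
    \<open>r\<close>, later a value of either law, removes the points where they may vanish.\<close>
  have log_AB: "r * log b (pAB i j) = r * log b (pA i) + r * log b (pB j)"
    if "r > 0 \<Longrightarrow> pAB i j > 0" "r \<ge> 0" for i j r
  proof (cases "r = 0")
    case False
    with that have "pAB i j \<noteq> 0" by simp
    then have "pA i \<noteq> 0" "pB j \<noteq> 0" unfolding AB by auto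
    then have "pA i > 0" "pB j > 0" by (simp_all add: order.strict_iff_order)
    then show ?thesis by (simp add: AB log_mult distrib_left)
  qed simp
  have pos: "pAB i j > 0" if "pABCD i j k l > 0" for i j k l
    using that by (rule pmass_pos_mono) simp_all
  show "joint_sum (\<lambda>i j k l. coupling i j k l * log b (pAB i j)) =
    joint_sum (\<lambda>i j k l. pABCD i j k l * log b (pAB i j))"
    using joint_sum_coupling_ACD[of "\<lambda>i k l. log b (pA i)"] joint_sum_coupling_BCD[of "\<lambda>j k l. log b (pB j)"]
    by (simp add: log_AB pos coupling_pos_marginals coupling_nonneg joint_sum_add cong: joint_sum_cong)
qed

text \<open>Independence of \<open>B\<close> and \<open>D\<close> given \<open>C\<close> reduces
  \<open>coupling\<close> to \<open>pACD * pBC / pC\<close>. Summing out \<open>l\<close> gives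
  \<open>pAC * pBC / pC = pABC\<close>, so both laws have the same \<open>ABC\<close>
  marginal.\<close>

lemma ingleton_nonneg_if_BD_cond_independent:
  assumes BD: "\<And>j k l. pBCD j k l * pC k = pBC j k * pCD k l"
  shows "ingleton b M A B C D \<ge> 0"
proof (rule ingleton_nonneg_if_coupling)
  have "(\<Sum>l\<in>RD. coupling i j k l) = pABC i j k" for i j k
  proof (cases "pC k = 0")
    case True
    then have "pABC i j k = 0" "pACD i k l = 0" for l
      by (rule pmass_eq_0_mono; simp)+
    then show ?thesis by (simp add: coupling_def)
  next
    case False
    have "coupling i j k l = pACD i k l * (pBC j k / pC k)" for l
    proof (cases "pCD k l = 0")
      case True
      then have "pACD i k l = 0" by (rule pmass_eq_0_mono) simp_all
      then show ?thesis by (simp add: coupling_def)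
    next
      case nz: False
      have "pBCD j k l = pBC j k * pCD k l / pC k"
        using BD[of j k l] False by (simp add: field_simps)
      then show ?thesis using nz by (simp add: coupling_def)
    qed
    then have "(\<Sum>l\<in>RD. coupling i j k l) = (\<Sum>l\<in>RD. pACD i k l) * (pBC j k / pC k)"
      by (simp only: sum_distrib_right)
    also have "(\<Sum>l\<in>RD. pACD i k l) = pAC i k"
      by (rule pmass_marginal) auto
    also have "pAC i k * (pBC j k / pC k) = pABC i j k"
      using AB_indep_C[of i j k] False by (simp add: field_simps)
    finally show ?thesis .
  qed
  moreover have "(\<Sum>l\<in>RD. pABCD i j k l) = pABC i j k" for i j k
    by (rule pmass_marginal) auto
  ultimately show "joint_sum (\<lambda>i j k l. coupling i j k l * log b (pAB i j)) =
    joint_sum (\<lambda>i j k l. pABCD i j k l * log b (pAB i j))"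
    by (simp add: joint_sum_def flip: sum_distrib_right)
qed

text \<open>Where \<open>pABC > 0\<close>, it equals \<open>pAB\<close>, so
  \<open>pAB = pAC * pBC / pC\<close> there and the logarithm splits into functions of
  \<open>(i, k)\<close> and \<open>(j, k)\<close>.\<close>

lemma ingleton_nonneg_if_determined:
  assumes det: "\<And>i j k. pABC i j k > 0 \<Longrightarrow> pABC i j k = pAB i j"
  shows "ingleton b M A B C D \<ge> 0"
proof (rule ingleton_nonneg_if_coupling)
  have log_AB: "r * log b (pAB i j) =
      r * (log b (pAC i k) - log b (pC k)) + r * log b (pBC j k)"
    if "r > 0 \<Longrightarrow> pABC i j k > 0" "r \<ge> 0" for i j k r
  proof (cases "r = 0")
    case False
    with that have pos: "pABC i j k > 0" by simp
    have *: "pAC i k > 0" "pBC j k > 0" "pC k > 0"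
      using pos by (rule pmass_pos_mono; simp)+
    have "log b (pAB i j) + log b (pC k) = log b (pAC i k) + log b (pBC j k)"
      using arg_cong[OF AB_indep_C[of i j k], of "log b"] pos * det[OF pos]
      by (simp add: log_mult)
    then have "log b (pAB i j) = (log b (pAC i k) - log b (pC k)) + log b (pBC j k)" by linarith
    then show ?thesis by (simp only: distrib_left)
  qed simp
  have pos: "pABC i j k > 0" if "pABCD i j k l > 0" for i j k l
    using that by (rule pmass_pos_mono) simp_all
  have "coupling i j k l * log b (pAB i j) = coupling i j k l * (log b (pAC i k) - log b (pC k))
      + coupling i j k l * log b (pBC j k)" for i j k l
    \<comment> \<open>The support of \<open>coupling\<close> lies within \<open>pABC > 0\<close>, so
      the splitting is valid under this law too.\<close>
    by (rule log_AB[OF coupling_pos_marginals(10) coupling_nonneg])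
  moreover have "pABCD i j k l * log b (pAB i j) = pABCD i j k l * (log b (pAC i k) - log b (pC k))
      + pABCD i j k l * log b (pBC j k)" for i j k l
    by (rule log_AB[OF pos pmass_nonneg])
  ultimately show "joint_sum (\<lambda>i j k l. coupling i j k l * log b (pAB i j)) =
    joint_sum (\<lambda>i j k l. pABCD i j k l * log b (pAB i j))"
    using joint_sum_coupling_ACD[of "\<lambda>i k l. log b (pAC i k) - log b (pC k)"]
      joint_sum_coupling_BCD[of "\<lambda>j k l. log b (pBC j k)"]
    by (simp only: joint_sum_add)
qed

end

section \<open>The three conditional inequalities\<close>

lemma ingleton_conditional_inequalities:
  "(cond_mutual_info b M A B C = 0 \<and> mutual_info b M A B = 0
      \<longrightarrow> ingleton b M A B C D \<ge> 0)
   \<and> (cond_mutual_info b M A B C = 0 \<and> cond_mutual_info b M B D C = 0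
      \<longrightarrow> ingleton b M A B C D \<ge> 0)
   \<and> (cond_mutual_info b M A B C = 0 \<and> cond_entropy b M C (\<lambda>\<omega>. (A \<omega>, B \<omega>)) = 0
      \<longrightarrow> ingleton b M A B C D \<ge> 0)"
proof (intro conjI impI; elim conjE)
  assume AB_C: "cond_mutual_info b M A B C = 0"
  note AB = cond_mutual_info_eq_0D[OF simple(1,2,3) AB_C]
  show "ingleton b M A B C D \<ge> 0" if "mutual_info b M A B = 0"
    by (rule ingleton_nonneg_if_independent[OF AB mutual_info_eq_0D[OF simple(1,2) that]])
  show "ingleton b M A B C D \<ge> 0" if "cond_mutual_info b M B D C = 0"
    by (rule ingleton_nonneg_if_BD_cond_independent[OF AB BD_cond_independentI[OF that]])
  show "ingleton b M A B C D \<ge> 0" if "cond_entropy b M C (\<lambda>\<omega>. (A \<omega>, B \<omega>)) = 0"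
    by (rule ingleton_nonneg_if_determined[OF AB determinedI[OF that]])
qed

end

theorem theorem1:
  fixes M :: "'w measure" and b :: real
    and A :: "'w \<Rightarrow> 'a" and B :: "'w \<Rightarrow> 'b" and C :: "'w \<Rightarrow> 'c" and D :: "'w \<Rightarrow> 'd"
  assumes "prob_space M" and "b > 1"
    and "simple_function M A" and "simple_function M B"
    and "simple_function M C" and "simple_function M D"
  shows "(cond_mutual_info b M A B C = 0 \<and> mutual_info b M A B = 0
            \<longrightarrow> ingleton b M A B C D \<ge> 0)
       \<and> (cond_mutual_info b M A B C = 0 \<and> cond_mutual_info b M B D C = 0
            \<longrightarrow> ingleton b M A B C D \<ge> 0)
       \<and> (cond_mutual_info b M A B C = 0 \<and> cond_entropy b M C (\<lambda>\<omega>. (A \<omega>, B \<omega>)) = 0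
            \<longrightarrow> ingleton b M A B C D \<ge> 0)"
proof -
  have "four_variables M b A B C D"
    using assms by (simp add: four_variables_def four_variables_axioms_def information_space_def
        information_space_axioms_def)
  then show ?thesis
    by (rule four_variables.ingleton_conditional_inequalities)
qed

end
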